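(* Let $N=\{p^{\lambda},\ p^{\lambda}q,\ p^2q^2,\ pqr,\ p^2qr,\ pqrs : p,q,r,s \text{ distinct primes},\ \lambda\geqslant 1\}$. Let $n\in N$ and let $S$ be a square-free subset of $\mathbb{Z}_n$ with $|S|\mid n$ and $\gcd(|S|,n/|S|)=1$, such that the Cayley sum graph $\mathrm{CS}(\mathbb{Z}_n,S)$ is connected. Then $\mathrm{CS}(\mathbb{Z}_n,S)$ admits a total perfect code if and only if $s\not\equiv s'\pmod{|S|}$ for all distinct $s,s'\in S$.
   Context: For an abelian group $G$ and $S\subseteq G$, the Cayley sum graph $\mathrm{CS}(G,S)$ has vertex set $G$, two vertices $g,h$ adjacent iff $g+h\in S$ and $g\neq h$. A total perfect code of a graph is a set $C$ of vertices such that every vertex has exactly one neighbor in $C$. $S$ is square-free if it contains no element of the form $y+y$, $y\in G$. Elements of $\mathbb{Z}_n$ are identified with integers $0,\dots,n-1$. *)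

theory Defs
  imports
    "HOL-Computational_Algebra.Primes"
    "HOL-Number_Theory.Cong"
    "HOL-Algebra.Elementary_Groups"
    "Graph_Theory.Digraph_Component"
begin

text \<open>
  Simple undirected graphs are loop-free symmetric digraphs whose arcs are pairs of vertices.
  Abelian groups are written multiplicatively, following \<open>HOL-Algebra\<close>; the group
  \<open>integer_mod_group n\<close> has carrier \<open>{0..<int n}\<close> for \<open>n > 0\<close>, and its
  operation is addition modulo \<open>n\<close>.
\<close>

definition cayley_sum_graph :: "('a, 'b) monoid_scheme \<Rightarrow> 'a set \<Rightarrow> 'a pair_pre_digraph" where
  "cayley_sum_graph G S =
     \<lparr> pverts = carrier G,
       parcs = {(g, h). g \<in> carrier G \<and> h \<in> carrier G \<and> g \<otimes>\<^bsub>G\<^esub> h \<in> S \<and> g \<noteq> h} \<rparr>"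

lemma pair_bidirected_digraph_cayley_sum_graph:
  assumes "comm_group G"
  shows "pair_bidirected_digraph (cayley_sum_graph G S)"
proof -
  interpret comm_group G by fact
  show ?thesis
    by unfold_locales
      (auto simp: cayley_sum_graph_def symmetric_def sym_def m_comm)
qed

definition total_perfect_code :: "'a pair_pre_digraph \<Rightarrow> 'a set \<Rightarrow> bool" where
  "total_perfect_code \<Gamma> C \<longleftrightarrow>
     C \<subseteq> pverts \<Gamma> \<and> (\<forall>v \<in> pverts \<Gamma>. \<exists>!c. c \<in> C \<and> (v, c) \<in> parcs \<Gamma>)"

definition square_free_subset :: "('a, 'b) monoid_scheme \<Rightarrow> 'a set \<Rightarrow> bool" where
  "square_free_subset G S \<longleftrightarrow>
     S \<subseteq> carrier G \<and> \<not> (\<exists>y \<in> carrier G. y \<otimes>\<^bsub>G\<^esub> y \<in> S)"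

definition N_orders :: "nat set" where
  "N_orders =
     {p ^ l | p l. prime p \<and> l \<ge> 1} \<union>
     {p ^ l * q | p l q. prime p \<and> prime q \<and> distinct [p, q] \<and> l \<ge> 1} \<union>
     {p\<^sup>2 * q\<^sup>2 | p q. prime p \<and> prime q \<and> distinct [p, q]} \<union>
     {p * q * r | p q r. prime p \<and> prime q \<and> prime r \<and> distinct [p, q, r]} \<union>
     {p\<^sup>2 * q * r | p q r. prime p \<and> prime q \<and> prime r \<and> distinct [p, q, r]} \<union>
     {p * q * r * s | p q r s. prime p \<and> prime q \<and> prime r \<and> prime s \<and> distinct [p, q, r, s]}"

end

theory Submission
  imports Defs "HOL-Computational_Algebra.Polynomial"
begin

text \<open>
  By square-freeness no loop is ever discarded from the sum graph, so a total perfect code \<open>C\<close>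
  is the same as a tiling \<open>\<int>\<^sub>n = S \<oplus> (-C)\<close>. Tijdeman's theorem says that in a tiling
  \<open>A \<oplus> B\<close> the factor \<open>A\<close> may be replaced by \<open>k A\<close> for every \<open>k\<close> coprime to \<open>|A|\<close>; for a
  prime \<open>k = p\<close> one compares \<open>A(x)\<^sup>p B(x)\<close> with \<open>A(x\<^sup>p) B(x)\<close> modulo \<open>p\<close> and \<open>x\<^sup>n - 1\<close>.
  Applied with \<open>k = |S|\<close> to the factor \<open>-C\<close>, whose order is \<open>n / |S|\<close>, it shows that
  every residue modulo \<open>|S|\<close> is represented by an element of \<open>S\<close>. Conversely, if \<open>S\<close> is a
  complete residue system modulo \<open>|S|\<close>, the multiples of \<open>|S|\<close> form a total perfect code.
\<close>

section \<open>Sums of the coefficients along a residue class\<close>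

text \<open>This is the coefficient at \<open>g\<close> of the image of \<open>p\<close> modulo
  \<open>x^n - 1\<close>, that is, in the semiring of formal sums over the cyclic group of order
  \<open>n\<close>. The index \<open>g\<close> need not be reduced.\<close>

definition residue_coeff_sum :: "nat \<Rightarrow> nat \<Rightarrow> nat poly \<Rightarrow> nat" where
  "residue_coeff_sum n g p = (\<Sum>i\<le>degree p. of_bool [i = g] (mod n) * coeff p i)"

lemma residue_coeff_sum_bound:
  assumes "degree p \<le> N"
  shows "residue_coeff_sum n g p = (\<Sum>i\<le>N. of_bool [i = g] (mod n) * coeff p i)"
  unfolding residue_coeff_sum_def
  by (rule sum.mono_neutral_left) (use assms in \<open>auto simp: coeff_eq_0\<close>)

lemma residue_coeff_sum_0 [simp]: "residue_coeff_sum n g 0 = 0"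
  by (simp add: residue_coeff_sum_def)

lemma residue_coeff_sum_add:
  "residue_coeff_sum n g (p + q) = residue_coeff_sum n g p + residue_coeff_sum n g q"
proof -
  let ?N = "max (degree p) (degree q)"
  have "degree (p + q) \<le> ?N" by (rule degree_add_le_max)
  then show ?thesis
    by (simp add: residue_coeff_sum_bound[of _ ?N] distrib_left sum.distrib del: sum_of_bool_mult_eq)
qed

lemma residue_coeff_sum_sum:
  "residue_coeff_sum n g (sum F A) = (\<Sum>a\<in>A. residue_coeff_sum n g (F a))"
  by (induction A rule: infinite_finite_induct) (simp_all add: residue_coeff_sum_add)

lemma residue_coeff_sum_of_nat_mult:
  "residue_coeff_sum n g (of_nat k * p) = k * residue_coeff_sum n g p"
  by (induction k) (simp_all add: residue_coeff_sum_add algebra_simps)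

lemma residue_coeff_sum_monom:
  "residue_coeff_sum n g (monom 1 k) = of_bool [k = g] (mod n)"
proof -
  have "residue_coeff_sum n g (monom 1 k) =
      (\<Sum>i\<le>k. of_bool [i = g] (mod n) * coeff (monom 1 k) i)"
    by (rule residue_coeff_sum_bound) (rule degree_monom_le)
  also have "\<dots> = (\<Sum>i\<in>{k}. of_bool [i = g] (mod n) * coeff (monom 1 k) i)"
    by (rule sum.mono_neutral_right) auto
  finally show ?thesis by simp
qed

text \<open>Multiplying by \<open>x^j\<close> rotates the coefficients modulo
  \<open>x^n - 1\<close>. The index \<open>g + (n - 1) * j\<close> stands for \<open>g - j\<close>,
  which truncated subtraction on naturals would spoil.\<close>

lemma residue_coeff_sum_monom_mult:
  assumes "n > 0"
  shows "residue_coeff_sum n g (monom 1 j * p) = residue_coeff_sum n (g + (n - 1) * j) p"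
proof -
  have shift: "[i + j = g] (mod n) \<longleftrightarrow> [i = g + (n - 1) * j] (mod n)" for i
  proof -
    have "g + (n - 1) * j + j = g + n * j"
      using assms by (cases n) simp_all
    then have "[g + (n - 1) * j + j = g] (mod n)"
      unfolding cong_def by (metis mod_mult_self2)
    then show ?thesis
      by (metis cong_add_rcancel_nat cong_sym cong_trans)
  qed
  have "degree (monom 1 j * p) \<le> degree p + j"
    using degree_mult_le[of "monom 1 j" p] degree_monom_le[of "1::nat" j] by linarith
  then have "residue_coeff_sum n g (monom 1 j * p) =
      (\<Sum>i\<le>degree p + j. of_bool [i = g] (mod n) * coeff (monom 1 j * p) i)"
    by (rule residue_coeff_sum_bound)
  \<comment> \<open>The dropped indices are those below \<open>j\<close>, where the shifted
    polynomial has coefficient zero.\<close>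
  also have "\<dots> = (\<Sum>i\<in>(\<lambda>i. i + j) ` {..degree p}. of_bool [i = g] (mod n) * coeff (monom 1 j * p) i)"
  proof (rule sum.mono_neutral_right)
    show "\<forall>i\<in>{..degree p + j} - (\<lambda>i. i + j) ` {..degree p}.
        of_bool [i = g] (mod n) * coeff (monom 1 j * p) i = 0"
    proof
      fix i assume i: "i \<in> {..degree p + j} - (\<lambda>i. i + j) ` {..degree p}"
      have "i < j"
      proof (rule ccontr)
        assume "\<not> i < j"
        then have "i = (i - j) + j" "i - j \<in> {..degree p}" using i by auto
        then show False using i by blast
      qed
      then show "of_bool [i = g] (mod n) * coeff (monom 1 j * p) i = 0"
        by (simp add: coeff_monom_mult)
    qed
  qed auto
  also have "\<dots> = (\<Sum>i\<le>degree p. of_bool [i + j = g] (mod n) * coeff p i)"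
    by (subst sum.reindex) (auto simp: coeff_monom_mult)
  finally show ?thesis
    by (simp add: residue_coeff_sum_def shift)
qed

section \<open>Tijdeman's theorem\<close>

text \<open>The Frobenius identity modulo \<open>p\<close>, with an explicit multiple of
  \<open>p\<close> in place of a congruence so that it makes sense over natural
  coefficients.\<close>

lemma prime_power_sum_eq:
  fixes f :: "'a \<Rightarrow> 'b::comm_semiring_1"
  assumes "prime p" "finite I"
  shows "\<exists>h. (\<Sum>i\<in>I. f i) ^ p = (\<Sum>i\<in>I. f i ^ p) + of_nat p * h"
  using \<open>finite I\<close>
proof (induction I rule: finite_induct)
  case empty
  then show ?case using prime_gt_0_nat[OF \<open>prime p\<close>] by (auto simp: power_0_left intro!: exI[of _ 0])
next
  case (insert i I)
  then obtain h where h: "(\<Sum>i\<in>I. f i) ^ p = (\<Sum>i\<in>I. f i ^ p) + of_nat p * h" by blast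
  let ?s = "\<Sum>i\<in>I. f i"
  let ?t = "\<lambda>k. of_nat (p choose k) * f i ^ k * ?s ^ (p - k)"
  have p: "p > 0" using prime_gt_0_nat[OF \<open>prime p\<close>] .
  \<comment> \<open>The two extreme binomial terms are split off; \<open>p\<close> divides the
    coefficients of all others.\<close>
  have "{..p} = insert 0 (insert p {0<..<p})" using p by auto
  then have "(f i + ?s) ^ p = ?s ^ p + (f i ^ p + (\<Sum>k\<in>{0<..<p}. ?t k))"
    using p by (simp add: binomial_ring)
  also have "(\<Sum>k\<in>{0<..<p}. ?t k) =
      (\<Sum>k\<in>{0<..<p}. of_nat p * (of_nat ((p choose k) div p) * f i ^ k * ?s ^ (p - k)))"
  proof (rule sum.cong)
    fix k assume "k \<in> {0<..<p}"
    then have "p dvd (p choose k)"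
      using \<open>prime p\<close> by (intro dvd_choose_prime) auto
    then have "of_nat (p choose k) = (of_nat p * of_nat ((p choose k) div p) :: 'b)"
      by (metis dvd_mult_div_cancel of_nat_mult)
    then show "?t k = of_nat p * (of_nat ((p choose k) div p) * f i ^ k * ?s ^ (p - k))"
      by (simp add: mult.assoc)
  qed simp
  finally have "(f i + ?s) ^ p = (f i ^ p + (\<Sum>i\<in>I. f i ^ p)) + of_nat p *
      (h + (\<Sum>k\<in>{0<..<p}. of_nat ((p choose k) div p) * f i ^ k * ?s ^ (p - k)))"
    by (simp add: h algebra_simps flip: sum_distrib_left)
  then show ?case using insert.hyps by auto
qed

text \<open>Indexed families replace sets so that a factor can be dilated, \<open>f\<close> becoming
  \<open>k * f\<close>, while the index set and its cardinality stay fixed. A tiling is the case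
  where every count is 1.\<close>

definition rep_count ::
    "nat \<Rightarrow> ('a \<Rightarrow> nat) \<Rightarrow> 'a set \<Rightarrow> ('b \<Rightarrow> nat) \<Rightarrow> 'b set \<Rightarrow> nat \<Rightarrow> nat" where
  "rep_count n f I h J g = card {(i, j) \<in> I \<times> J. [f i + h j = g] (mod n)}"

lemma residue_coeff_sum_rep_count:
  assumes "finite I" "finite J"
  shows "residue_coeff_sum n g ((\<Sum>i\<in>I. monom 1 (f i)) * (\<Sum>j\<in>J. monom 1 (h j)))
    = rep_count n f I h J g"
proof -
  have "(\<Sum>i\<in>I. monom 1 (f i)) * (\<Sum>j\<in>J. monom 1 (h j)) =
      (\<Sum>(i, j)\<in>I \<times> J. monom (1::nat) (f i + h j))"
    by (simp add: sum_product mult_monom sum.cartesian_product)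
  also have "residue_coeff_sum n g \<dots> = (\<Sum>x\<in>I \<times> J. of_bool [f (fst x) + h (snd x) = g] (mod n))"
    by (simp add: residue_coeff_sum_sum residue_coeff_sum_monom case_prod_unfold del: One_nat_def)
  also have "\<dots> = card {x \<in> I \<times> J. [f (fst x) + h (snd x) = g] (mod n)}"
    using assms by (simp add: Int_def)
  also have "\<dots> = rep_count n f I h J g"
    unfolding rep_count_def by (rule arg_cong[of _ _ card]) auto
  finally show ?thesis .
qed

text \<open>Modulo \<open>x^n - 1\<close>, \<open>p\<close> is \<open>1 + x + ... + x^(n-1)\<close>,
  which every rotation fixes. Each factor is a sum of \<open>card I\<close> monomials and so only
  multiplies it by \<open>card I\<close>.\<close>

lemma residue_coeff_sum_power_mult:
  assumes "n > 0" and "\<And>g. residue_coeff_sum n g p = 1"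
  shows "residue_coeff_sum n g ((\<Sum>i\<in>I. monom 1 (f i)) ^ k * p) = card I ^ k"
proof (induction k arbitrary: g)
  case 0
  then show ?case using assms by simp
next
  case (Suc k)
  show ?case
    by (simp add: sum_distrib_right mult.assoc residue_coeff_sum_sum
        residue_coeff_sum_monom_mult assms(1) Suc del: One_nat_def)
qed

text \<open>Every pair falls into exactly one residue class. For a tiling this yields
  \<open>card I * card J = n\<close>.\<close>

lemma sum_rep_count:
  assumes "n > 0" "finite I" "finite J"
  shows "(\<Sum>g<n. rep_count n f I h J g) = card I * card J"
proof -
  have "(\<Sum>g<n. rep_count n f I h J g) =
      card (\<Union>g\<in>{..<n}. {(i, j) \<in> I \<times> J. [f i + h j = g] (mod n)})"
    unfolding rep_count_def using assms(2,3)
    by (subst card_UN_disjoint) (auto simp: cong_def intro: finite_subset[of _ "I \<times> J"])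
  also have "(\<Union>g\<in>{..<n}. {(i, j) \<in> I \<times> J. [f i + h j = g] (mod n)}) = I \<times> J"
    using assms(1) by (auto simp: cong_def intro!: bexI[of _ "(_ + _) mod n"])
  finally show ?thesis by (simp add: card_cartesian_product)
qed

text \<open>All coefficients of \<open>?A ^ p * ?B\<close> are \<open>card I ^ (p - 1)\<close>,
  which is prime to \<open>p\<close>, so no count of the dilated family, congruent to it modulo
  \<open>p\<close>, can vanish. As the counts over all residues add up to \<open>n\<close>, each
  equals 1.\<close>

lemma rep_count_prime_mult:
  assumes n: "n > 0" and fin: "finite I" "finite J"
    and one: "\<And>g. rep_count n f I h J g = 1"
    and p: "prime p" "\<not> p dvd card I"
  shows "rep_count n (\<lambda>i. p * f i) I h J g = 1"
proof -
  let ?A = "\<Sum>i\<in>I. monom (1::nat) (f i)" and ?B = "\<Sum>j\<in>J. monom (1::nat) (h j)"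
  let ?r = "rep_count n (\<lambda>i. p * f i) I h J"
  obtain H where H: "?A ^ p = (\<Sum>i\<in>I. monom 1 (f i) ^ p) + of_nat p * H"
    using prime_power_sum_eq[OF p(1) fin(1)] by blast
  have pos: "?r g \<ge> 1" for g
  proof (rule ccontr)
    assume "\<not> ?r g \<ge> 1"
    then have r0: "?r g = 0" by simp
    have "?A ^ p * ?B = (\<Sum>i\<in>I. monom 1 (p * f i)) * ?B + of_nat p * (H * ?B)"
      by (simp add: H monom_power algebra_simps del: One_nat_def)
    then have "residue_coeff_sum n g (?A ^ p * ?B) = p * residue_coeff_sum n g (H * ?B)"
      using r0 fin
      by (simp only: residue_coeff_sum_add residue_coeff_sum_of_nat_mult
          residue_coeff_sum_rep_count)
    moreover have "?A ^ p * ?B = ?A ^ (p - 1) * (?A * ?B)"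
      \<comment> \<open>One factor \<open>?A\<close> is kept next to \<open>?B\<close>, since
        \<open>?A * ?B\<close> has all residue sums equal to 1.\<close>
      using prime_gt_0_nat[OF p(1)] by (metis mult.assoc power_minus_mult)
    moreover have "residue_coeff_sum n g (?A ^ (p - 1) * (?A * ?B)) = card I ^ (p - 1)"
      using fin one n by (intro residue_coeff_sum_power_mult) (simp_all add: residue_coeff_sum_rep_count del: One_nat_def)
    ultimately have "p dvd card I ^ (p - 1)" by simp
    then show False using p prime_dvd_power by blast
  qed
  have total: "(\<Sum>g<n. ?r g) = n"
    using sum_rep_count[OF n fin, of "\<lambda>i. p * f i" h] sum_rep_count[OF n fin, of f h]
    by (simp add: one)
  have eq1: "?r g = 1" if "g < n" for g
  proof (rule ccontr)
    assume "?r g \<noteq> 1"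
    then have "1 < ?r g" using pos[of g] by linarith
    then have "(\<Sum>g<n. 1) < (\<Sum>g<n. ?r g)"
      using that pos by (intro sum_strict_mono_ex1) auto
    then show False using total by simp
  qed
  have "?r g = ?r (g mod n)" by (simp add: rep_count_def cong_def)
  then show ?thesis using eq1[of "g mod n"] n by simp
qed

text \<open>The prime factors of \<open>k\<close> are applied one at a time; the result of each
  dilation is again a tiling with the same \<open>card I\<close>, so the prime case can be
  repeated.\<close>

lemma rep_count_coprime_mult:
  assumes n: "n > 0" and fin: "finite I" "finite J"
    and one: "\<And>g. rep_count n f I h J g = 1"
    and k: "k > 0" "coprime k (card I)"
  shows "rep_count n (\<lambda>i. k * f i) I h J g = 1"
  using k
proof (induction k arbitrary: g rule: prime_divisors_induct)
  case zero
  then show ?case by simp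
next
  case (unit x)
  then show ?case using one by simp
next
  case (factor p k)
  have "\<not> p dvd card I"
    using factor by (meson coprime_common_divisor dvd_triv_left not_prime_unit)
  moreover have "\<And>g. rep_count n (\<lambda>i. k * f i) I h J g = 1"
    using factor by simp
  ultimately show ?case
    using rep_count_prime_mult[OF n fin, of "\<lambda>i. k * f i" h p] factor(1)
    by (simp add: mult.assoc)
qed

text \<open>After dilating the first family by \<open>card J\<close>, its terms vanish modulo
  \<open>card J\<close>, a divisor of \<open>n\<close>. So \<open>h\<close> alone must reach all
  \<open>card J\<close> residues, which \<open>card J\<close> indices can do only
  injectively.\<close>

lemma inj_on_mod_of_rep_count:
  assumes n: "n > 0" and fin: "finite I" "finite J"
    and one: "\<And>g. rep_count n f I h J g = 1"
    and coprime: "coprime (card J) (card I)"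
  shows "inj_on (\<lambda>j. h j mod card J) J"
proof -
  have IJ: "card I * card J = n"
    using sum_rep_count[OF n fin, of f h] by (simp add: one)
  then have m: "card J > 0" using n by (cases "card J") auto
  have "{..<card J} \<subseteq> (\<lambda>j. h j mod card J) ` J"
  proof
    fix g assume g: "g \<in> {..<card J}"
    have "rep_count n (\<lambda>i. card J * f i) I h J g = 1"
      by (rule rep_count_coprime_mult) (use assms m in auto)
    then have "{(i, j) \<in> I \<times> J. [card J * f i + h j = g] (mod n)} \<noteq> {}"
      unfolding rep_count_def by (metis card.empty zero_neq_one)
    then obtain i j where j: "j \<in> J" "[card J * f i + h j = g] (mod n)" by auto
    then have "[card J * f i + h j = g] (mod card J)"
      using IJ by (metis cong_dvd_modulus_nat dvd_triv_right)
    then have "h j mod card J = g" using g by (simp add: cong_def)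
    then show "g \<in> (\<lambda>j. h j mod card J) ` J" using j by blast
  qed
  then have "(\<lambda>j. h j mod card J) ` J = {..<card J}" using m by auto
  then show ?thesis using fin by (intro eq_card_imp_inj_on) auto
qed

section \<open>Total perfect codes\<close>

lemma total_perfect_code_cayley_sum_graph_iff:
  assumes n: "n > 0" and sf: "square_free_subset (integer_mod_group n) S"
  shows "total_perfect_code (cayley_sum_graph (integer_mod_group n) S) C \<longleftrightarrow>
    C \<subseteq> {0..<int n} \<and> (\<forall>v\<in>{0..<int n}. \<exists>!c. c \<in> C \<and> (v + c) mod int n \<in> S)"
proof -
  \<comment> \<open>A discarded loop at \<open>v\<close> would need \<open>v + v\<close> in
    \<open>S\<close>, against square-freeness.\<close>
  have "v \<noteq> c" if "v \<in> {0..<int n}" "(v + c) mod int n \<in> S" for v c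
    using that sf n by (auto simp: square_free_subset_def carrier_integer_mod_group
        integer_mod_group_def integer_group_def)
  then have arcs: "C \<subseteq> {0..<int n} \<Longrightarrow> v \<in> {0..<int n} \<Longrightarrow>
      (c \<in> C \<and> (v, c) \<in> parcs (cayley_sum_graph (integer_mod_group n) S)) \<longleftrightarrow>
      (c \<in> C \<and> (v + c) mod int n \<in> S)" for v c
    using n by (auto simp: cayley_sum_graph_def carrier_integer_mod_group mult_integer_mod_group)
  have pverts: "pverts (cayley_sum_graph (integer_mod_group n) S) = {0..<int n}"
    using n by (simp add: cayley_sum_graph_def carrier_integer_mod_group)
  show ?thesis
    unfolding total_perfect_code_def pverts
    by (intro conj_cong ball_cong refl arg_cong[of _ _ Ex1] ext arcs)
qed

lemma inj_on_mod_of_code: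
  fixes S C :: "int set"
  assumes n: "n > 0" and S: "S \<subseteq> {0..<int n}"
    and gcd: "gcd (card S) (n div card S) = 1"
    and C: "C \<subseteq> {0..<int n}"
    and code: "\<And>v. v \<in> {0..<int n} \<Longrightarrow> \<exists>!c. c \<in> C \<and> (v + c) mod int n \<in> S"
  shows "inj_on (\<lambda>s. s mod int (card S)) S"
proof -
  \<comment> \<open>A natural representative of \<open>-c\<close>; the value \<open>n\<close> at
    \<open>c = 0\<close> is harmless, as only residues modulo \<open>n\<close> count.\<close>
  let ?f = "\<lambda>c. nat (int n - c)"
  have fin: "finite C" "finite S" using C S finite_subset by blast+
  have one: "rep_count n ?f C nat S g = 1" for g
  proof -
    have rep: "[?f c + nat s = g] (mod n) \<longleftrightarrow> s = (int (g mod n) + c) mod int n"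
      if "c \<in> C" "s \<in> S" for c s
    proof -
      have cs: "0 \<le> c" "c < int n" "0 \<le> s" "s < int n" using that C S by auto
      have "[?f c + nat s = g] (mod n) \<longleftrightarrow> [int n - c + s = int g] (mod int n)"
        using cs by (simp flip: cong_int_iff)
      also have "\<dots> \<longleftrightarrow> [s = int g + c] (mod int n)"
      proof -
        have "int n - c + s - int g = (s - (int g + c)) + int n" by simp
        then show ?thesis
          unfolding cong_iff_dvd_diff by (metis dvd_add_triv_right_iff)
      qed
      also have "\<dots> \<longleftrightarrow> s = (int g + c) mod int n"
        using cs by (simp add: cong_def)
      finally show ?thesis by (simp add: zmod_int mod_add_left_eq)
    qed
    \<comment> \<open>The representations of \<open>g\<close> correspond to the neighbors in
      \<open>C\<close> of the vertex \<open>g mod n\<close>, of which there is exactly one.\<close>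
    have "int (g mod n) \<in> {0..<int n}" using n by simp
    from code[OF this] obtain c where c: "c \<in> C" "(int (g mod n) + c) mod int n \<in> S"
      and uniq: "\<And>c'. c' \<in> C \<Longrightarrow> (int (g mod n) + c') mod int n \<in> S \<Longrightarrow> c' = c" by blast
    have "{(c, s) \<in> C \<times> S. [?f c + nat s = g] (mod n)} = {(c, (int (g mod n) + c) mod int n)}"
      (is "?L = {?x}")
    proof (rule subset_antisym)
      show "?L \<subseteq> {?x}"
      proof
        fix y assume "y \<in> ?L"
        then obtain c' s where y: "y = (c', s)" "c' \<in> C" "s \<in> S" "[?f c' + nat s = g] (mod n)"
          by blast
        then have s: "s = (int (g mod n) + c') mod int n" using rep by blast
        then have "c' = c" using uniq[of c'] y by blast
        then show "y \<in> {?x}" using s y(1) by blast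
      qed
      have "[?f c + nat ((int (g mod n) + c) mod int n) = g] (mod n)"
        using rep[OF c] by blast
      then show "{?x} \<subseteq> ?L" using c by blast
    qed
    then show ?thesis by (simp add: rep_count_def)
  qed
  \<comment> \<open>The cofactor of \<open>card S\<close> in \<open>n\<close> is thus
    \<open>card C\<close>, and the gcd hypothesis makes the two orders coprime.\<close>
  have "card C * card S = n"
    using sum_rep_count[OF n fin, of ?f nat] by (simp add: one)
  then have "n div card S = card C" using n by (cases "card S = 0") auto
  then have "coprime (card S) (card C)" using gcd by (simp add: coprime_iff_gcd_eq_1)
  then have inj: "inj_on (\<lambda>s. nat s mod card S) S"
    using inj_on_mod_of_rep_count[OF n fin] one by blast
  have nat_mod: "nat s mod card S = nat (s mod int (card S))" if "s \<in> S" for s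
    using that S by (auto simp: nat_mod_distrib)
  show ?thesis
  proof (rule inj_onI)
    fix s s' assume ss': "s \<in> S" "s' \<in> S" "s mod int (card S) = s' mod int (card S)"
    then have "nat s mod card S = nat s' mod card S" by (simp only: nat_mod)
    then show "s = s'" using inj_onD[OF inj _ ss'(1,2)] by blast
  qed
qed

lemma code_of_inj_on_mod:
  fixes S :: "int set"
  assumes n: "n > 0" and S: "S \<subseteq> {0..<int n}" and dvd: "card S dvd n"
    and inj: "inj_on (\<lambda>s. s mod int (card S)) S"
    and v: "v \<in> {0..<int n}"
  shows "\<exists>!c. c \<in> {c \<in> {0..<int n}. int (card S) dvd c} \<and> (v + c) mod int n \<in> S"
proof -
  let ?m = "int (card S)"
  have m: "?m > 0" using dvd n by (cases "card S") auto
  have mn: "?m dvd int n" using dvd by simp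
  have "(\<lambda>s. s mod ?m) ` S \<subseteq> {0..<?m}" using m by auto
  then have "(\<lambda>s. s mod ?m) ` S = {0..<?m}"
    by (intro card_subset_eq) (simp_all add: card_image inj)
  then have "v mod ?m \<in> (\<lambda>s. s mod ?m) ` S" using m by simp
  then obtain s where s: "s \<in> S" "s mod ?m = v mod ?m" by auto
  show ?thesis
  \<comment> \<open>The witness is forced by \<open>v + c = s\<close> modulo \<open>n\<close>; it is
    a multiple of \<open>?m\<close> because \<open>s\<close> was chosen congruent to
    \<open>v\<close>.\<close>
  proof (rule ex1I[of _ "(s - v) mod int n"])
    have "?m dvd s - v" using s by (simp add: mod_eq_dvd_iff)
    moreover have "(v + (s - v) mod int n) mod int n = s"
      using s S by (auto simp: mod_add_right_eq)
    ultimately show "(s - v) mod int n \<in> {c \<in> {0..<int n}. ?m dvd c} \<and>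
        (v + (s - v) mod int n) mod int n \<in> S"
      using n s mn by (simp add: dvd_mod)
  next
    fix c assume c: "c \<in> {c \<in> {0..<int n}. ?m dvd c} \<and> (v + c) mod int n \<in> S"
    \<comment> \<open>As \<open>?m\<close> divides both \<open>n\<close> and \<open>c\<close>, the
      sum keeps the residue of \<open>v\<close>, and \<open>s\<close> is the only element of
      \<open>S\<close> with that residue.\<close>
    have "(v + c) mod int n mod ?m = v mod ?m"
      using c mn by (auto simp: mod_mod_cancel elim!: dvdE)
    then have "(v + c) mod int n = s"
      using inj s c unfolding inj_on_def by metis
    then have "(s - v) mod int n = c mod int n"
      by (metis add_diff_cancel_left' mod_diff_left_eq)
    then show "c = (s - v) mod int n" using c by simp
  qed
qed

theorem theorem3p13:
  fixes n :: nat and S :: "int set"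
  assumes "n \<in> N_orders"
    and "square_free_subset (integer_mod_group n) S"
    and "card S dvd n"
    and "gcd (card S) (n div card S) = 1"
    and "Digraph_Component.connected (with_proj (cayley_sum_graph (integer_mod_group n) S))"
  shows "(\<exists>C. total_perfect_code (cayley_sum_graph (integer_mod_group n) S) C) \<longleftrightarrow>
         (\<forall>s \<in> S. \<forall>s' \<in> S. s \<noteq> s' \<longrightarrow> \<not> [s = s'] (mod int (card S)))"
proof -
  have n: "n > 0"
    using assms(1) by (auto simp: N_orders_def prime_gt_0_nat)
  have S: "S \<subseteq> {0..<int n}"
    using assms(2) n by (auto simp: square_free_subset_def carrier_integer_mod_group)
  have "(\<exists>C. total_perfect_code (cayley_sum_graph (integer_mod_group n) S) C) \<longleftrightarrow>
      inj_on (\<lambda>s. s mod int (card S)) S"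
    unfolding total_perfect_code_cayley_sum_graph_iff[OF n assms(2)]
  proof
    assume "inj_on (\<lambda>s. s mod int (card S)) S"
    from code_of_inj_on_mod[OF n S assms(3) this]
    show "\<exists>C\<subseteq>{0..<int n}. \<forall>v\<in>{0..<int n}. \<exists>!c. c \<in> C \<and> (v + c) mod int n \<in> S"
      \<comment> \<open>The same subgroup, the multiples of \<open>card S\<close>, serves all
        vertices at once.\<close>
      by (intro exI[of _ "{c \<in> {0..<int n}. int (card S) dvd c}"]) auto
  next
    assume "\<exists>C\<subseteq>{0..<int n}. \<forall>v\<in>{0..<int n}. \<exists>!c. c \<in> C \<and> (v + c) mod int n \<in> S"
    then obtain C where C: "C \<subseteq> {0..<int n}"
      and code: "\<forall>v\<in>{0..<int n}. \<exists>!c. c \<in> C \<and> (v + c) mod int n \<in> S" by blast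
    show "inj_on (\<lambda>s. s mod int (card S)) S"
      using inj_on_mod_of_code[OF n S assms(4) C] code by simp
  qed
  then show ?thesis
    by (auto simp: inj_on_def cong_def)
qed

end
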